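(* Let $T\subset\mathbb{R}^2$ be a triangle and let $P\subset\mathbb{R}^2$ be any finite set of points. Then the points of $P$ can be colored with two colors such that any homothetic copy of $T$ that contains at least $12$ points of $P$ contains points of $P$ of both colors.
   Context: A triangle is a nondegenerate triangular region in the plane: the convex hull of three non-collinear points (closed triangle) or its interior (open triangle). A homothetic copy of $T$ is a set $\lambda T+v$ with $\lambda>0$ and $v\in\mathbb{R}^2$. *)

theory Defs
  imports "HOL-Analysis.Analysis"
begin

definition is_triangle :: "(real^2) set \<Rightarrow> bool" where
  "is_triangle T \<longleftrightarrow> (\<exists>a b c. \<not> collinear {a, b, c} \<and>
     (T = convex hull {a, b, c} \<or> T = interior (convex hull {a, b, c})))"

definition homothetic_copy :: "(real^2) set \<Rightarrow> (real^2) set \<Rightarrow> bool" where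
  "homothetic_copy T S \<longleftrightarrow> (\<exists>r v. r > 0 \<and> S = (\<lambda>x. r *\<^sub>R x + v) ` T)"

end

theory Submission
  imports Defs
begin

text \<open>
  In barycentric coordinates the homothetic copies of a triangle are octants, so three linear
  orders on \<open>P\<close> are given and each set to be coloured is an intersection of three initial segments.
  Insert the points along the third order: at every moment all quadrants (``wedges'') in the first two
  orders must contain an edge of a growing graph \<open>E\<close>, which is properly 2-coloured at the end.
  Apart from points all of whose wedges already contain an edge, only two kinds of points occur:
  a staircase \<open>S\<close>, and pending points \<open>Q\<close> that lie in distinct components of \<open>E\<close>, none of them above
  a point of \<open>S\<close>.
  A new point below some pending points is joined to all of them and replaces them.
  As soon as a wedge free of \<open>S\<close> contains four pending points \<open>q1, q2, q3, q4\<close> from left to right, the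
  edges \<open>q1 q2\<close> and \<open>q3 q4\<close> are added and \<open>q2, q3\<close> move into the staircase, replacing what
  lies above them. Hence a wedge without edges contains at most two points of \<open>S\<close>; these split its
  pending points into three wedges free of \<open>S\<close>, and it has at most \<open>2 + 3 * 3 = 11\<close> points.
\<close>

section \<open>Colouring points against octants\<close>

definition initial_segment :: "'a set \<Rightarrow> ('a \<Rightarrow> 'b::linorder) \<Rightarrow> 'a set \<Rightarrow> bool" where
  "initial_segment P f A \<longleftrightarrow> A \<subseteq> P \<and> (\<forall>p\<in>A. \<forall>q\<in>P. f q \<le> f p \<longrightarrow> q \<in> A)"

lemma ex_maximizer:
  fixes f :: "'a \<Rightarrow> 'b::linorder"
  assumes "finite P" "P \<noteq> {}"
  obtains m where "m \<in> P" "\<And>p. p \<in> P \<Longrightarrow> f p \<le> f m"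
proof -
  have "Max (f ` P) \<in> f ` P" using assms by simp
  then obtain m where "m \<in> P" "f m = Max (f ` P)" by (metis imageE)
  then show thesis using that[of m] assms by simp
qed

text \<open>Ties of \<open>f\<close> are broken arbitrarily: a point of largest value is ranked
  above all others. This gives the points pairwise distinct coordinates.\<close>

lemma ex_injective_rank:
  fixes f :: "'a \<Rightarrow> 'b::linorder"
  assumes "finite P"
  shows "\<exists>r :: 'a \<Rightarrow> nat. inj_on r P \<and> (\<forall>p\<in>P. \<forall>q\<in>P. f p < f q \<longrightarrow> r p < r q)"
  using assms
proof (induction "card P" arbitrary: P)
  case 0
  then have "P = {}" by simp
  then show ?case by simp
next
  case (Suc n)
  then have "P \<noteq> {}" by auto
  then obtain m where m: "m \<in> P" "\<And>p. p \<in> P \<Longrightarrow> f p \<le> f m"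
    using ex_maximizer Suc.prems by blast
  define R where "R = P - {m}"
  have "n = card R" "finite R" using Suc m by (auto simp: R_def)
  then obtain r :: "'a \<Rightarrow> nat"
    where r: "inj_on r R" "\<forall>p\<in>R. \<forall>q\<in>R. f p < f q \<longrightarrow> r p < r q"
    using Suc.hyps(1) by blast
  obtain k where k: "\<And>p. p \<in> R \<Longrightarrow> r p < k"
    using \<open>finite R\<close> finite_nat_set_iff_bounded[of "r ` R"] by auto
  have P: "P = insert m R" "m \<notin> R" using m by (auto simp: R_def)
  have "inj_on (r(m := k)) P"
  proof (rule inj_onI)
    fix p q assume *: "p \<in> P" "q \<in> P" "(r(m := k)) p = (r(m := k)) q"
    then show "p = q"
      using inj_onD[OF r(1), of p q] k[of p] k[of q] P by (cases "p = m"; cases "q = m") auto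
  qed
  moreover have "\<forall>p\<in>P. \<forall>q\<in>P. f p < f q \<longrightarrow> (r(m := k)) p < (r(m := k)) q"
  proof (intro ballI impI)
    fix p q assume *: "p \<in> P" "q \<in> P" "f p < f q"
    then have "p \<noteq> m" using m(2)[of q] by auto
    then show "(r(m := k)) p < (r(m := k)) q" using * r(2) k P by (cases "q = m") auto
  qed
  ultimately show ?case by blast
qed

text \<open>An initial segment contains a tie class of \<open>f\<close> entirely or not at all, so
  it remains initial after ties are broken.\<close>

lemma initial_segment_rank:
  fixes r :: "'a \<Rightarrow> nat"
  assumes "finite P" "initial_segment P f A"
    and "\<forall>p\<in>P. \<forall>q\<in>P. f p < f q \<longrightarrow> r p < r q"
  shows "\<exists>k. A = {p\<in>P. r p < k}"
proof (cases "A = {}")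
  case True
  then show ?thesis by (intro exI[of _ 0]) auto
next
  case False
  have A: "finite A" "A \<subseteq> P" using assms by (auto simp: initial_segment_def intro: finite_subset)
  obtain m where m: "m \<in> A" "\<And>p. p \<in> A \<Longrightarrow> r p \<le> r m"
    using ex_maximizer False A(1) by blast
  have "p \<in> A" if "p \<in> P" "r p \<le> r m" for p
    using assms(2,3) m(1) that A(2) unfolding initial_segment_def by (meson leD leI subsetD)
  then show ?thesis using m A by (intro exI[of _ "Suc (r m)"]) (auto simp: less_Suc_eq_le)
qed

text \<open>Used repeatedly to list points from left to right. The bound on \<open>card\<close> also
  supplies finiteness, since infinite sets have cardinality 0.\<close>

lemma ex_least_point:
  fixes x :: "'a \<Rightarrow> nat"
  assumes "card A \<ge> Suc n" "inj_on x A"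
  shows "\<exists>q\<in>A. (\<forall>r\<in>A - {q}. x q < x r) \<and> card (A - {q}) \<ge> n"
proof -
  have "card A > 0" using assms(1) by linarith
  then have "finite A" "A \<noteq> {}" by (auto simp: card_gt_0_iff)
  then obtain q where q: "q \<in> A" "\<And>r. r \<in> A \<Longrightarrow> x q \<le> x r"
    using ex_has_least_nat[of "\<lambda>q. q \<in> A" _ x] by blast
  have "x q < x r" if "r \<in> A - {q}" for r
    using q(2)[of r] inj_onD[OF assms(2), of q r] q(1) that by fastforce
  moreover have "card (A - {q}) \<ge> n" using q(1) \<open>finite A\<close> assms(1) by simp
  ultimately show ?thesis using q(1) by blast
qed

section \<open>Wedges and the invariant of the incremental construction\<close>

locale two_orders =
  fixes x y :: "'a \<Rightarrow> nat"
begin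

text \<open>With strict bounds, a coordinate of a point serves directly as a bound that excludes
  this point.\<close>

definition wedge :: "nat \<Rightarrow> nat \<Rightarrow> 'a set" where
  "wedge \<alpha> \<beta> = {p. x p < \<alpha> \<and> y p < \<beta>}"

definition below :: "'a \<Rightarrow> 'a \<Rightarrow> bool" where
  "below p q \<longleftrightarrow> x p \<le> x q \<and> y p \<le> y q"

definition has_edge :: "('a \<times> 'a) set \<Rightarrow> 'a set \<Rightarrow> bool" where
  "has_edge E A \<longleftrightarrow> (\<exists>a\<in>A. \<exists>b\<in>A. (a, b) \<in> E)"

text \<open>A settled singleton is a point that can leave \<open>S\<close> and \<open>Q\<close> for
  good, because edges are only ever added. Settled pairs limit how many staircase points share an
  edgeless wedge.\<close>

definition settled :: "('a \<times> 'a) set \<Rightarrow> 'a set \<Rightarrow> bool" where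
  "settled E A \<longleftrightarrow> (\<forall>\<alpha> \<beta>. A \<subseteq> wedge \<alpha> \<beta> \<longrightarrow> has_edge E (wedge \<alpha> \<beta>))"

text \<open>This encodes that the points of \<open>Q\<close> lie in distinct components of the bipartite graph \<open>E\<close>.\<close>

definition colors_freely :: "('a \<times> 'a) set \<Rightarrow> 'a set \<Rightarrow> bool" where
  "colors_freely E Q \<longleftrightarrow>
     (\<forall>g. \<exists>c :: 'a \<Rightarrow> bool. (\<forall>q\<in>Q. c q = g q) \<and> (\<forall>(a, b)\<in>E. c a \<noteq> c b))"

text \<open>The clause relating \<open>S\<close> to \<open>Q\<close> puts each pending point
  strictly left of or strictly under each staircase point. The last clause keeps three staircase
  points from sharing an edgeless wedge.\<close>

definition state :: "'a set \<Rightarrow> ('a \<times> 'a) set \<Rightarrow> 'a set \<Rightarrow> 'a set \<Rightarrow> bool" where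
  "state P E S Q \<longleftrightarrow>
     finite P \<and> inj_on x P \<and> inj_on y P \<and> E \<subseteq> P \<times> P \<and> S \<subseteq> P \<and> Q \<subseteq> P \<and>
     colors_freely E Q \<and>
     (\<forall>p\<in>P - S - Q. settled E {p}) \<and>
     (\<forall>p\<in>Q. \<forall>q\<in>Q. below p q \<longrightarrow> p = q) \<and>
     (\<forall>s\<in>S. \<forall>q\<in>Q. \<not> below s q) \<and>
     (\<forall>r\<in>S. \<forall>s\<in>S. \<forall>t\<in>S. x r < x s \<longrightarrow> x s < x t \<longrightarrow> settled E {r, s} \<or> settled E {s, t})"

definition crowded :: "'a set \<Rightarrow> 'a set \<Rightarrow> bool" where
  "crowded S Q \<longleftrightarrow> (\<exists>\<alpha> \<beta>. S \<inter> wedge \<alpha> \<beta> = {} \<and> card (Q \<inter> wedge \<alpha> \<beta>) \<ge> 4)"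

lemma stateI:
  assumes "finite P" "inj_on x P" "inj_on y P" "E \<subseteq> P \<times> P" "S \<subseteq> P" "Q \<subseteq> P" "colors_freely E Q"
    and "\<And>p. p \<in> P - S - Q \<Longrightarrow> settled E {p}"
    and "\<And>p q. p \<in> Q \<Longrightarrow> q \<in> Q \<Longrightarrow> below p q \<Longrightarrow> p = q"
    and "\<And>s q. s \<in> S \<Longrightarrow> q \<in> Q \<Longrightarrow> \<not> below s q"
    and "\<And>r s t. r \<in> S \<Longrightarrow> s \<in> S \<Longrightarrow> t \<in> S \<Longrightarrow> x r < x s \<Longrightarrow> x s < x t \<Longrightarrow> settled E {r, s} \<or> settled E {s, t}"
  shows "state P E S Q"
  unfolding state_def by (intro conjI ballI impI; (fact assms | rule assms; assumption))

lemma stateD: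
  assumes "state P E S Q"
  shows "finite P" "inj_on x P" "inj_on y P" "E \<subseteq> P \<times> P" "S \<subseteq> P" "Q \<subseteq> P" "colors_freely E Q"
    and "\<forall>p\<in>P - S - Q. settled E {p}"
    and "\<forall>p\<in>Q. \<forall>q\<in>Q. below p q \<longrightarrow> p = q"
    and "\<forall>s\<in>S. \<forall>q\<in>Q. \<not> below s q"
    and "\<forall>r\<in>S. \<forall>s\<in>S. \<forall>t\<in>S. x r < x s \<longrightarrow> x s < x t \<longrightarrow> settled E {r, s} \<or> settled E {s, t}"
  using assms unfolding state_def by - (elim conjE, assumption)+

section \<open>Preserving the invariant: inserting a point and relieving crowding\<close>

lemma has_edge_mono: "has_edge E A \<Longrightarrow> E \<subseteq> E' \<Longrightarrow> A \<subseteq> A' \<Longrightarrow> has_edge E' A'"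
  unfolding has_edge_def by blast

lemma settled_mono: "settled E A \<Longrightarrow> E \<subseteq> E' \<Longrightarrow> A \<subseteq> A' \<Longrightarrow> settled E' A'"
  unfolding settled_def using has_edge_mono[OF _ _ order_refl] by (meson subset_trans)

lemma wedge_below: "below p q \<Longrightarrow> q \<in> wedge \<alpha> \<beta> \<Longrightarrow> p \<in> wedge \<alpha> \<beta>"
  unfolding wedge_def below_def by auto

lemma settled_edge:
  assumes "(a, b) \<in> E" "\<And>\<alpha> \<beta>. A \<subseteq> wedge \<alpha> \<beta> \<Longrightarrow> a \<in> wedge \<alpha> \<beta> \<and> b \<in> wedge \<alpha> \<beta>"
  shows "settled E A"
  using assms unfolding settled_def has_edge_def by blast

lemma colors_freelyI:
  assumes "\<And>g :: 'a \<Rightarrow> bool. \<exists>c. (\<forall>q\<in>Q. c q = g q) \<and> (\<forall>a b. (a, b) \<in> E \<longrightarrow> c a \<noteq> c b)"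
  shows "colors_freely E Q"
  unfolding colors_freely_def Ball_def[of E] split_paired_All prod.case by (intro allI assms)

lemma colors_freelyE:
  fixes g :: "'a \<Rightarrow> bool"
  assumes "colors_freely E Q"
  obtains c where "\<And>q. q \<in> Q \<Longrightarrow> c q = g q" "\<And>a b. (a, b) \<in> E \<Longrightarrow> c a \<noteq> c b"
proof -
  obtain c :: "'a \<Rightarrow> bool" where c: "\<forall>q\<in>Q. c q = g q" "\<forall>(a, b)\<in>E. c a \<noteq> c b"
    using assms[unfolded colors_freely_def, THEN spec, of g] by (elim exE conjE)
  show thesis
    by (rule that[of c]) (use c in auto)
qed

text \<open>If an old point lies below \<open>w\<close>, an edge to it settles \<open>w\<close>.
  Otherwise \<open>w\<close> becomes pending, and its edges settle the pending points above it,
  since a wedge containing one of them contains \<open>w\<close>.\<close>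

lemma state_add:
  assumes st: "state P E S Q" and w: "w \<notin> P" "inj_on x (insert w P)" "inj_on y (insert w P)"
  shows "\<exists>E' S' Q'. E \<subseteq> E' \<and> state (insert w P) E' S' Q'"
proof (cases "\<exists>p\<in>P. below p w")
  case True
  then obtain p where p: "p \<in> P" "below p w" by blast
  define E' where "E' = insert (w, p) E"
  have "settled E' {w}"
    by (rule settled_edge[of w p]) (use p in \<open>auto simp: E'_def intro: wedge_below\<close>)
  have "colors_freely E' Q"
  proof (rule colors_freelyI)
    fix g :: "'a \<Rightarrow> bool"
    obtain c where c: "\<And>q. q \<in> Q \<Longrightarrow> c q = g q" "\<And>a b. (a, b) \<in> E \<Longrightarrow> c a \<noteq> c b"
      using colors_freelyE[OF stateD(7)[OF st]] by blast
    \<comment> \<open>No old edge meets \<open>w\<close>, so \<open>w\<close> can be coloured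
      last.\<close>
    define d where "d = c(w := \<not> c p)"
    have d: "d w = (\<not> c p)" "\<And>v. v \<in> P \<Longrightarrow> d v = c v" using w(1) by (auto simp: d_def)
    have "d a \<noteq> d b" if ab: "(a, b) \<in> E'" for a b
    proof (cases "(a, b) \<in> E")
      case True
      then have "a \<in> P" "b \<in> P" using stateD(4)[OF st] by auto
      then show ?thesis using c(2)[OF True] by (simp add: d)
    next
      case False
      then show ?thesis using ab p(1) by (simp add: E'_def d)
    qed
    moreover have "d q = g q" if "q \<in> Q" for q
      using c(1)[OF that] d(2) stateD(6)[OF st] that by auto
    ultimately show "\<exists>c. (\<forall>q\<in>Q. c q = g q) \<and> (\<forall>a b. (a, b) \<in> E' \<longrightarrow> c a \<noteq> c b)" by blast
  qed
  have "E \<subseteq> E'" "E' \<subseteq> insert w P \<times> insert w P"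
    using stateD(4)[OF st] p unfolding E'_def by auto
  have old: "settled E A \<Longrightarrow> settled E' A" for A
    by (rule settled_mono[OF _ \<open>E \<subseteq> E'\<close> order_refl])
  have good: "settled E' {v}" if "v \<in> insert w P - S - Q" for v
    using that old stateD(8)[OF st] \<open>settled E' {w}\<close> by blast
  have triple: "settled E' {r, s} \<or> settled E' {s, t}"
    if "r \<in> S" "s \<in> S" "t \<in> S" "x r < x s" "x s < x t" for r s t
    using that old stateD(11)[OF st] by blast
  have "state (insert w P) E' S Q"
  proof (rule stateI)
    show "finite (insert w P)" using stateD(1)[OF st] by simp
    show "S \<subseteq> insert w P" "Q \<subseteq> insert w P" using stateD(5,6)[OF st] by auto
    show "below p q \<Longrightarrow> p = q" if "p \<in> Q" "q \<in> Q" for p q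
      using stateD(9)[OF st] that by blast
    show "\<not> below s q" if "s \<in> S" "q \<in> Q" for s q
      using stateD(10)[OF st] that by blast
  qed fact+
  then show ?thesis using \<open>E \<subseteq> E'\<close> by blast
next
  case False
  define U where "U = {q\<in>Q. below w q}"
  define E' where "E' = E \<union> {w} \<times> U"
  define Q' where "Q' = insert w (Q - U)"
  define S' where "S' = {s\<in>S. \<not> (\<exists>q\<in>U. below q s)}"
  have E': "E \<subseteq> E'" by (auto simp: E'_def)
  have UP: "U \<subseteq> P" using stateD(6)[OF st] by (auto simp: U_def)
  \<comment> \<open>What lies above a point of \<open>U\<close> also lies above \<open>w\<close>.
    This settles \<open>U\<close> itself and the staircase points that are left out of
    \<open>S'\<close>.\<close>
  have U: "settled E' {p}" if "q \<in> U" "below q p" for p q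
    by (rule settled_edge[of w q])
       (use that in \<open>auto simp: E'_def U_def intro: wedge_below\<close>)
  have good: "settled E' {p}" if p: "p \<in> insert w P - S' - Q'" for p
  proof -
    consider "p \<in> U" | q where "q \<in> U" "below q p" | "p \<in> P - S - Q"
      using p unfolding S'_def Q'_def by blast
    then show ?thesis
    proof cases
      case 1
      then show ?thesis using U[of p p] by (simp add: below_def)
    next
      case 2
      then show ?thesis using U by blast
    next
      case 3
      then show ?thesis using settled_mono[OF bspec[OF stateD(8)[OF st] 3] E' order_refl] by blast
    qed
  qed
  have free: "colors_freely E' Q'"
  proof (rule colors_freelyI)
    fix g :: "'a \<Rightarrow> bool"
    \<comment> \<open>Since \<open>U\<close> is part of \<open>Q\<close>, all its points can receive
      the same colour, opposite to the one prescribed for \<open>w\<close>.\<close>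
    obtain c where c: "\<And>q. q \<in> Q \<Longrightarrow> c q = (if q \<in> U then \<not> g w else g q)"
        "\<And>a b. (a, b) \<in> E \<Longrightarrow> c a \<noteq> c b"
      using colors_freelyE[OF stateD(7)[OF st], of "\<lambda>q. if q \<in> U then \<not> g w else g q"] by blast
    define d where "d = c(w := g w)"
    have d: "d w = g w" "\<And>v. v \<in> P \<Longrightarrow> d v = c v" using w(1) by (auto simp: d_def)
    have dU: "d u = (\<not> g w)" if "u \<in> U" for u
      using that c(1)[of u] d(2)[of u] UP by (auto simp: U_def)
    have "d a \<noteq> d b" if ab: "(a, b) \<in> E'" for a b
    proof (cases "(a, b) \<in> E")
      case True
      then have "a \<in> P" "b \<in> P" using stateD(4)[OF st] by auto
      then show ?thesis using c(2)[OF True] by (simp add: d)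
    next
      case False
      then have "a = w" "b \<in> U" using ab by (auto simp: E'_def)
      then show ?thesis by (simp add: d dU)
    qed
    moreover have "d q = g q" if "q \<in> Q'" for q
      using that c(1)[of q] d stateD(6)[OF st] by (cases "q = w") (auto simp: Q'_def)
    ultimately show "\<exists>c. (\<forall>q\<in>Q'. c q = g q) \<and> (\<forall>a b. (a, b) \<in> E' \<longrightarrow> c a \<noteq> c b)" by blast
  qed
  \<comment> \<open>Pending points above \<open>w\<close> were removed with \<open>U\<close>, and in
    this case no old point is below \<open>w\<close>.\<close>
  have anti': "p = q" if "p \<in> Q'" "q \<in> Q'" "below p q" for p q
    using stateD(6,9)[OF st] False that unfolding Q'_def U_def by blast
  have nb: "\<not> below s q" if "s \<in> S'" "q \<in> Q'" for s q
    using stateD(5,10)[OF st] False that unfolding Q'_def S'_def by blast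
  have triple: "settled E' {r, s} \<or> settled E' {s, t}"
    if "r \<in> S'" "s \<in> S'" "t \<in> S'" "x r < x s" "x s < x t" for r s t
  proof -
    have "settled E {r, s} \<or> settled E {s, t}" using stateD(11)[OF st] that by (auto simp: S'_def)
    then show ?thesis using settled_mono[OF _ E' order_refl] by blast
  qed
  have sub: "E' \<subseteq> insert w P \<times> insert w P" "S' \<subseteq> insert w P" "Q' \<subseteq> insert w P"
    using stateD(4-6)[OF st] UP by (auto simp: E'_def S'_def Q'_def)
  have "finite (insert w P)" using stateD(1)[OF st] by simp
  from stateI[OF this w(2,3) sub free good anti' nb triple]
  have "state (insert w P) E' S' Q'" .
  then show ?thesis using E' by blast
qed

text \<open>Every old staircase point avoids the crowded wedge, so it lies beyond
  \<open>\<alpha>\<close> or beyond \<open>\<beta>\<close>. Hence a remaining one shares no edgeless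
  wedge with \<open>q2\<close> or \<open>q3\<close>: on the left the edge \<open>q1 q2\<close>
  intervenes, on the right \<open>q3 q4\<close>. Only the pair \<open>q2\<close>, \<open>q3\<close>
  is left unsettled by the new edges.\<close>

lemma state_uncrowd_step:
  assumes st: "state P E S Q" and cr: "crowded S Q"
  shows "\<exists>E' S' Q'. E \<subseteq> E' \<and> state P E' S' Q' \<and> card Q' < card Q"
proof -
  obtain \<alpha> \<beta> where V: "S \<inter> wedge \<alpha> \<beta> = {}" "card (Q \<inter> wedge \<alpha> \<beta>) \<ge> 4"
    using cr unfolding crowded_def by blast
  define A where "A = Q \<inter> wedge \<alpha> \<beta>"
  have inj: "inj_on x A" using st unfolding state_def A_def by (meson inf_le1 inj_on_subset)
  obtain q1 where q1: "q1 \<in> A" "\<forall>r\<in>A - {q1}. x q1 < x r" "card (A - {q1}) \<ge> 3"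
    using ex_least_point[of 3 A] inj V(2) unfolding A_def[symmetric] by auto
  define B where "B = A - {q1}"
  have injB: "inj_on x B" using inj unfolding B_def by (meson Diff_subset inj_on_subset)
  obtain q2 where q2: "q2 \<in> B" "\<forall>r\<in>B - {q2}. x q2 < x r" "card (B - {q2}) \<ge> 2"
    using ex_least_point[of 2 B] injB q1(3) unfolding B_def[symmetric] by auto
  define C where "C = B - {q2}"
  have injC: "inj_on x C" using injB unfolding C_def by (meson Diff_subset inj_on_subset)
  obtain q3 where q3: "q3 \<in> C" "\<forall>r\<in>C - {q3}. x q3 < x r" "card (C - {q3}) \<ge> 1"
    using ex_least_point[of 1 C] injC q2(3) unfolding C_def[symmetric] by auto
  then obtain q4 where q4: "q4 \<in> C - {q3}"
    by (metis card.empty equals0I not_one_le_zero)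
  have Q: "q1 \<in> Q" "q2 \<in> Q" "q3 \<in> Q" "q4 \<in> Q"
    and W: "q1 \<in> wedge \<alpha> \<beta>" "q2 \<in> wedge \<alpha> \<beta>" "q3 \<in> wedge \<alpha> \<beta>" "q4 \<in> wedge \<alpha> \<beta>"
    and xs: "x q1 < x q2" "x q2 < x q3" "x q3 < x q4"
    using q1 q2 q3 q4 by (auto simp: A_def B_def C_def)
  \<comment> \<open>Pending points form an antichain, so \<open>y\<close> decreases as
    \<open>x\<close> increases.\<close>
  have anti: "y q < y p" if "p \<in> Q" "q \<in> Q" "x p < x q" for p q
    using st that unfolding state_def below_def by (metis less_imp_le_nat less_irrefl_nat not_le_imp_less)
  have ys: "y q2 < y q1" "y q3 < y q2" "y q4 < y q3" using anti Q xs by auto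
  have Wc: "x q4 < \<alpha>" "y q1 < \<beta>" using W by (auto simp: wedge_def)
  have out: "x s \<ge> \<alpha> \<or> y s \<ge> \<beta>" if "s \<in> S" for s
    using V(1) that by (auto simp: wedge_def not_less)
  define E' where "E' = E \<union> {(q1, q2), (q3, q4)}"
  define Q' where "Q' = Q - {q2, q3}"
  define T where "T = {s\<in>S. \<not> below q2 s \<and> \<not> below q3 s}"
  define S' where "S' = T \<union> {q2, q3}"
  have E': "E \<subseteq> E'" by (auto simp: E'_def)
  have e12: "settled E' A" if "\<And>\<alpha> \<beta>. A \<subseteq> wedge \<alpha> \<beta> \<Longrightarrow> q1 \<in> wedge \<alpha> \<beta> \<and> q2 \<in> wedge \<alpha> \<beta>" for A
    by (rule settled_edge[of q1 q2]) (use that in \<open>auto simp: E'_def\<close>)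
  have e34: "settled E' A" if "\<And>\<alpha> \<beta>. A \<subseteq> wedge \<alpha> \<beta> \<Longrightarrow> q3 \<in> wedge \<alpha> \<beta> \<and> q4 \<in> wedge \<alpha> \<beta>" for A
    by (rule settled_edge[of q3 q4]) (use that in \<open>auto simp: E'_def\<close>)
  \<comment> \<open>A point of \<open>S\<close> above \<open>q2\<close> or \<open>q3\<close> is outside the wedge, so it is also above \<open>q1\<close> and \<open>q2\<close>, or above \<open>q3\<close> and \<open>q4\<close>.\<close>
  have good: "settled E' {p}" if "p \<in> P - S' - Q'" for p
  proof (cases "p \<in> S")
    case True
    then have b: "below q2 p \<or> below q3 p" using that by (auto simp: S'_def T_def)
    from out[OF True] show ?thesis
    proof
      assume "x p \<ge> \<alpha>"
      then have "below q3 p \<and> below q4 p" using b xs ys Wc by (auto simp: below_def)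
      then show ?thesis by (intro e34) (auto intro: wedge_below)
    next
      assume "y p \<ge> \<beta>"
      then have "below q1 p \<and> below q2 p" using b xs ys Wc by (auto simp: below_def)
      then show ?thesis by (intro e12) (auto intro: wedge_below)
    qed
  next
    case False
    then have "p \<in> P - S - Q" using that by (auto simp: S'_def Q'_def)
    then show ?thesis using st settled_mono[OF _ E' order_refl] by (auto simp: state_def)
  qed
  have free: "colors_freely E' Q'"
  proof (rule colors_freelyI)
    fix g :: "'a \<Rightarrow> bool"
    \<comment> \<open>\<open>q1\<close> and \<open>q4\<close> keep their prescribed colours; the
      freedom at \<open>q2\<close> and \<open>q3\<close> is spent on the two new edges.\<close>
    obtain c where c: "\<And>q. q \<in> Q \<Longrightarrow> c q = (g(q2 := \<not> g q1, q3 := \<not> g q4)) q"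
        "\<And>a b. (a, b) \<in> E \<Longrightarrow> c a \<noteq> c b"
      using colors_freelyE[OF stateD(7)[OF st]] by blast
    have "q1 \<noteq> q2" "q1 \<noteq> q3" "q2 \<noteq> q3" "q4 \<noteq> q2" "q4 \<noteq> q3" using xs by auto
    then have "\<forall>a b. (a, b) \<in> E' \<longrightarrow> c a \<noteq> c b" "\<forall>q\<in>Q'. c q = g q"
      using c(2) c(1)[OF Q(1)] c(1)[OF Q(2)] c(1)[OF Q(3)] c(1)[OF Q(4)] c(1)
      unfolding E'_def Q'_def by auto
    then show "\<exists>c. (\<forall>q\<in>Q'. c q = g q) \<and> (\<forall>a b. (a, b) \<in> E' \<longrightarrow> c a \<noteq> c b)" by blast
  qed
  have anti': "p = q" if "p \<in> Q'" "q \<in> Q'" "below p q" for p q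
    using stateD(9)[OF st] that unfolding Q'_def by blast
  have nb: "\<not> below s q" if "s \<in> S'" "q \<in> Q'" for s q
    using stateD(9,10)[OF st] Q that unfolding Q'_def S'_def T_def by blast
  have triple: "settled E' {r, s} \<or> settled E' {s, t}"
    if S': "r \<in> S'" "s \<in> S'" "t \<in> S'" and lt: "x r < x s" "x s < x t" for r s t
  proof -
    \<comment> \<open>Being left of \<open>q2\<close>, the point \<open>s\<close> has
      \<open>y s \<ge> \<beta>\<close>, so it is higher than \<open>q1\<close>.\<close>
    have left: "settled E' {s, q}" if "s \<in> T" "x s < x q2" "q = q2 \<or> q = q3" for s q
    proof (rule e12)
      fix a b assume *: "{s, q} \<subseteq> wedge a b"
      have "y s \<ge> \<beta>" using out[of s] that xs Wc by (auto simp: T_def)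
      then show "q1 \<in> wedge a b \<and> q2 \<in> wedge a b"
        using * that(3) xs ys Wc by (auto simp: wedge_def)
    qed
    \<comment> \<open>Here \<open>y s \<ge> \<beta>\<close> alone would put \<open>s\<close> above
      \<open>q2\<close>, contrary to \<open>s \<in> T\<close>; so \<open>x s \<ge> \<alpha>\<close>,
      to the right of \<open>q4\<close>.\<close>
    have right: "settled E' {q, s}" if "s \<in> T" "x s > x q2" "q = q2 \<or> q = q3" for s q
    proof (rule e34)
      fix a b assume *: "{q, s} \<subseteq> wedge a b"
      have "x s \<ge> \<alpha>" using out[of s] that xs ys Wc by (auto simp: T_def below_def)
      then show "q3 \<in> wedge a b \<and> q4 \<in> wedge a b"
        using * that(3) xs ys Wc by (auto simp: wedge_def)
    qed
    have TP: "T \<subseteq> P" using st by (auto simp: T_def state_def)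
    have beyond: "x u > x q3" if "u \<in> T" "x u > x q2" for u
      using out[of u] that xs ys Wc by (auto simp: T_def below_def)
    \<comment> \<open>The cases locate the middle point. By \<open>beyond\<close>, no point of
      \<open>T\<close> lies between \<open>q2\<close> and \<open>q3\<close>, so either all three
      points are old or one of the two pairs consists of an old point and one of \<open>q2\<close>,
      \<open>q3\<close>.\<close>
    consider "s = q2" | "s = q3" | "s \<in> T" "x s < x q2" | "s \<in> T" "x s > x q2"
    proof -
      have "x s = x q2 \<Longrightarrow> s = q2"
        using stateD(2)[OF st] TP Q(2) stateD(6)[OF st] S'(2) xs by (auto simp: S'_def inj_on_def)
      then show thesis using S'(2) that unfolding S'_def by (metis Un_iff empty_iff insert_iff linorder_neqE_nat)
    qed
    then show ?thesis
    proof cases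
      case 1
      then have "r \<in> T" using S'(1) lt xs by (auto simp: S'_def)
      then show ?thesis using left[of r s] 1 lt by auto
    next
      case 2
      then have "t \<in> T" using S'(3) lt xs by (auto simp: S'_def)
      then show ?thesis using right[of t s] 2 lt xs by auto
    next
      case 3
      then have r: "r \<in> T" using S'(1) lt xs by (auto simp: S'_def)
      show ?thesis
      proof (cases "t \<in> T")
        case True
        then show ?thesis using stateD(11)[OF st] r 3 lt settled_mono[OF _ E' order_refl]
          unfolding T_def by blast
      next
        case False
        then have "t = q2 \<or> t = q3" using S'(3) by (auto simp: S'_def)
        then show ?thesis using left[of s t] 3 by auto
      qed
    next
      case 4
      then have t: "t \<in> T" using S'(3) lt xs beyond[of s] by (auto simp: S'_def)
      show ?thesis
      proof (cases "r \<in> T")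
        case True
        then show ?thesis using stateD(11)[OF st] t 4 lt settled_mono[OF _ E' order_refl]
          unfolding T_def by blast
      next
        case False
        then have "r = q2 \<or> r = q3" using S'(1) by (auto simp: S'_def)
        then show ?thesis using right[of s r] 4 by auto
      qed
    qed
  qed
  have sub: "E' \<subseteq> P \<times> P" "S' \<subseteq> P" "Q' \<subseteq> P"
    using stateD(4-6)[OF st] Q by (auto simp: E'_def S'_def T_def Q'_def)
  from stateI[OF stateD(1-3)[OF st] sub free good anti' nb triple]
  have "state P E' S' Q'" .
  moreover have "card Q' < card Q"
    using st Q unfolding Q'_def state_def
    by (intro psubset_card_mono) (auto intro: finite_subset)
  ultimately show ?thesis using E' by blast
qed

section \<open>Uncrowded states and the bound of eleven\<close>

lemma state_uncrowd:
  assumes "state P E S Q"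
  shows "\<exists>E' S' Q'. E \<subseteq> E' \<and> state P E' S' Q' \<and> \<not> crowded S' Q'"
  using assms
proof (induction "card Q" arbitrary: E S Q rule: less_induct)
  case less
  show ?case
  proof (cases "crowded S Q")
    case True
    then obtain E' S' Q' where "E \<subseteq> E'" "state P E' S' Q'" "card Q' < card Q"
      using state_uncrowd_step[OF less.prems] by blast
    then obtain E'' S'' Q'' where "E' \<subseteq> E''" "state P E'' S'' Q''" "\<not> crowded S'' Q''"
      using less.hyps[of Q' E' S'] by blast
    then show ?thesis using \<open>E \<subseteq> E'\<close> by (intro exI[of _ E''] exI[of _ S''] exI[of _ Q'']) auto
  qed (use less.prems in blast)
qed

text \<open>A wedge without edges contains only staircase and pending points. Its staircase points,
  at most two, cut the pending points into pieces covered by wedges free of \<open>S\<close>, each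
  holding at most three.\<close>

lemma uncrowded_wedge_edge:
  assumes st: "state P E S Q" and cr: "\<not> crowded S Q"
    and card: "card (P \<inter> wedge \<alpha> \<beta>) \<ge> 12"
  shows "has_edge E (wedge \<alpha> \<beta>)"
proof (rule ccontr)
  assume no: "\<not> has_edge E (wedge \<alpha> \<beta>)"
  define W where "W = wedge \<alpha> \<beta>"
  have fin: "finite P" "finite S" "finite Q"
    using stateD(1)[OF st] finite_subset[OF stateD(5)[OF st]] finite_subset[OF stateD(6)[OF st]] by auto
  have sub: "P \<inter> W \<subseteq> (S \<inter> W) \<union> (Q \<inter> W)"
  proof
    fix p assume p: "p \<in> P \<inter> W"
    have "\<not> settled E {p}" using p no by (auto simp: settled_def W_def)
    then show "p \<in> (S \<inter> W) \<union> (Q \<inter> W)" using p stateD(8)[OF st] by blast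
  qed
  have gap: "card (Q \<inter> wedge a b) \<le> 3" if "S \<inter> wedge a b = {}" for a b
  proof (rule ccontr)
    assume "\<not> card (Q \<inter> wedge a b) \<le> 3"
    then have "card (Q \<inter> wedge a b) \<ge> 4" by linarith
    then show False using cr that unfolding crowded_def by blast
  qed
  define Z where "Z = S \<inter> W"
  have injZ: "inj_on x Z" 
    by (rule inj_on_subset[OF stateD(2)[OF st]]) (use stateD(5)[OF st] in \<open>auto simp: Z_def\<close>)
  \<comment> \<open>Three points of \<open>Z\<close>, listed by \<open>x\<close>, would include a
    settled pair and so force an edge into \<open>W\<close>.\<close>
  have "card Z < 3"
  proof (rule ccontr)
    assume "\<not> card Z < 3"
    then obtain r where r: "r \<in> Z" "\<forall>u\<in>Z - {r}. x r < x u" "card (Z - {r}) \<ge> 2"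
      using ex_least_point[of 2 Z] injZ by auto
    define Y where "Y = Z - {r}"
    have "inj_on x Y" using injZ unfolding Y_def by (meson Diff_subset inj_on_subset)
    then obtain s where s: "s \<in> Y" "\<forall>u\<in>Y - {s}. x s < x u" "card (Y - {s}) \<ge> 1"
      using ex_least_point[of 1 Y] r(3) unfolding Y_def[symmetric] by auto
    then obtain t where t: "t \<in> Y - {s}"
      by (metis card.empty equals0I not_one_le_zero)
    have "r \<in> S" "s \<in> S" "t \<in> S" "x r < x s" "x s < x t" "{r, s} \<subseteq> W" "{s, t} \<subseteq> W"
      using r s t by (auto simp: Y_def Z_def)
    then have "settled E {r, s} \<or> settled E {s, t}" "{r, s} \<subseteq> W" "{s, t} \<subseteq> W"
      using stateD(11)[OF st] by blast+
    then have "has_edge E W" unfolding settled_def W_def by blast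
    then show False using no by (simp add: W_def)
  qed
  have sep: "x q < x z \<or> y q < y z" if "q \<in> Q" "z \<in> Z" for q z
    using stateD(10)[OF st] that unfolding Z_def below_def by (auto simp: not_le)
  have W: "wedge a b \<subseteq> W" if "a \<le> \<alpha>" "b \<le> \<beta>" for a b
    using that by (auto simp: W_def wedge_def)
  have Zc: "x z < \<alpha>" "y z < \<beta>" if "z \<in> Z" for z using that by (auto simp: Z_def W_def wedge_def)
  have clear: "card (Q \<inter> wedge a b) \<le> 3" if "a \<le> \<alpha>" "b \<le> \<beta>" "Z \<inter> wedge a b = {}" for a b
    using W[OF that(1,2)] that(3) by (intro gap) (auto simp: Z_def)
  consider "Z = {}" | z where "Z = {z}" | z1 z2 where "Z = {z1, z2}" "x z1 < x z2"
  proof -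
    have "finite Z" using fin by (simp add: Z_def)
    have "card Z = 0 \<or> card Z = 1 \<or> card Z = 2" using \<open>card Z < 3\<close> by linarith
    then show thesis
      using \<open>finite Z\<close> that injZ
      by (auto simp: card_1_singleton_iff card_2_iff) (metis doubleton_eq_iff inj_onD insertI1 insertI2 linorder_neqE_nat)
  qed
  then have "card (Z \<union> (Q \<inter> W)) \<le> 11"
  proof cases
    case 1
    then show ?thesis using clear[of \<alpha> \<beta>] by (simp add: W_def)
  next
    case 2
    let ?A = "Q \<inter> wedge (x z) \<beta>" and ?B = "Q \<inter> wedge \<alpha> (y z)"
    have "Z \<union> (Q \<inter> W) \<subseteq> {z} \<union> ?A \<union> ?B"
      using sep[of _ z] 2 by (auto simp: W_def wedge_def)
    then have "card (Z \<union> (Q \<inter> W)) \<le> card ({z} \<union> ?A \<union> ?B)"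
      using fin by (intro card_mono) auto
    also have "\<dots> \<le> 1 + card ?A + card ?B"
      using card_Un_le[of "{z} \<union> ?A" ?B] card_Un_le[of "{z}" ?A] by simp
    also have "\<dots> \<le> 1 + 3 + 3"
      using clear[of "x z" \<beta>] clear[of \<alpha> "y z"] Zc[of z] 2
      by (intro add_mono) (auto simp: wedge_def)
    finally show ?thesis by simp
  next
    case 3
    \<comment> \<open>A pending point is left of \<open>z1\<close>; or under \<open>z1\<close> and
      left of \<open>z2\<close>; or under both. The minimum covers either order of
      \<open>y z1\<close> and \<open>y z2\<close>.\<close>
    let ?A = "Q \<inter> wedge (x z1) \<beta>" and ?B = "Q \<inter> wedge (x z2) (y z1)"
      and ?C = "Q \<inter> wedge \<alpha> (min (y z1) (y z2))"
    have "Z \<union> (Q \<inter> W) \<subseteq> {z1, z2} \<union> ?A \<union> ?B \<union> ?C"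
      using sep[of _ z1] sep[of _ z2] 3 by (auto simp: W_def wedge_def)
    then have "card (Z \<union> (Q \<inter> W)) \<le> card ({z1, z2} \<union> ?A \<union> ?B \<union> ?C)"
      using fin by (intro card_mono) auto
    also have "\<dots> \<le> 2 + card ?A + card ?B + card ?C"
      using card_Un_le[of "{z1, z2} \<union> ?A \<union> ?B" ?C] card_Un_le[of "{z1, z2} \<union> ?A" ?B]
        card_Un_le[of "{z1, z2}" ?A] card_insert_le_m1[of 2 "{z2}" z1] by simp
    also have "\<dots> \<le> 2 + 3 + 3 + 3"
      using clear[of "x z1" \<beta>] clear[of "x z2" "y z1"] clear[of \<alpha> "min (y z1) (y z2)"] Zc[of z1] Zc[of z2] 3
      by (intro add_mono) (auto simp: wedge_def)
    finally show ?thesis by simp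
  qed
  moreover have "card (P \<inter> W) \<le> card (Z \<union> (Q \<inter> W))"
    using sub fin by (intro card_mono) (auto simp: Z_def)
  ultimately show False using card by (simp add: W_def)
qed

text \<open>Induction along \<open>z\<close>: a set whose third bound exceeds \<open>z w\<close>,
  for the last point \<open>w\<close>, is a full wedge of the current points. Any other set misses
  \<open>w\<close> and keeps the edge it received earlier.\<close>

lemma ex_edges:
  fixes z :: "'a \<Rightarrow> nat"
  assumes "finite P" "inj_on x P" "inj_on y P" "inj_on z P"
  shows "\<exists>E S Q. state P E S Q \<and>
    (\<forall>\<alpha> \<beta> \<gamma>. card {p\<in>P. x p < \<alpha> \<and> y p < \<beta> \<and> z p < \<gamma>} \<ge> 12 \<longrightarrow>
       has_edge E {p\<in>P. x p < \<alpha> \<and> y p < \<beta> \<and> z p < \<gamma>})"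
  using assms
proof (induction "card P" arbitrary: P)
  case 0
  then have "P = {}" by simp
  then have "state P {} {} {}" by (simp add: state_def colors_freely_def)
  moreover have "card {p\<in>P. x p < \<alpha> \<and> y p < \<beta> \<and> z p < \<gamma>} < 12" for \<alpha> \<beta> \<gamma>
    using \<open>P = {}\<close> by simp
  ultimately show ?case by (meson not_le)
next
  case (Suc n)
  then have "P \<noteq> {}" by auto
  then obtain w where w: "w \<in> P" "\<And>p. p \<in> P \<Longrightarrow> z p \<le> z w"
    using ex_maximizer[OF Suc.prems(1), of z] by metis
  define R where "R = P - {w}"
  have P: "P = insert w R" "w \<notin> R" using w by (auto simp: R_def)
  have "n = card R" "finite R" using Suc.hyps(2) Suc.prems(1) w(1) by (simp_all add: R_def)
  moreover have "inj_on x R" "inj_on y R" "inj_on z R"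
    using Suc.prems(2-4) unfolding P(1) by simp_all
  ultimately obtain E S Q where st: "state R E S Q"
    and E: "\<forall>\<alpha> \<beta> \<gamma>. card {p\<in>R. x p < \<alpha> \<and> y p < \<beta> \<and> z p < \<gamma>} \<ge> 12 \<longrightarrow>
       has_edge E {p\<in>R. x p < \<alpha> \<and> y p < \<beta> \<and> z p < \<gamma>}"
    using Suc.hyps(1)[of R] by blast
  obtain E1 S1 Q1 where E1: "E \<subseteq> E1" "state P E1 S1 Q1"
    using state_add[OF st P(2)] Suc.prems(2,3) unfolding P(1) by metis
  obtain E2 S2 Q2 where E2: "E1 \<subseteq> E2" "state P E2 S2 Q2" "\<not> crowded S2 Q2"
    using state_uncrowd[OF E1(2)] by blast
  have "has_edge E2 {p\<in>P. x p < \<alpha> \<and> y p < \<beta> \<and> z p < \<gamma>}"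
    if *: "card {p\<in>P. x p < \<alpha> \<and> y p < \<beta> \<and> z p < \<gamma>} \<ge> 12" for \<alpha> \<beta> \<gamma>
  proof (cases "z w < \<gamma>")
    case True
    then have eq: "{p\<in>P. x p < \<alpha> \<and> y p < \<beta> \<and> z p < \<gamma>} = P \<inter> wedge \<alpha> \<beta>"
      using le_less_trans[OF w(2) True] by (auto simp: wedge_def)
    have "has_edge E2 (wedge \<alpha> \<beta>)"
      using uncrowded_wedge_edge[OF E2(2,3)] *[unfolded eq] by blast
    then show ?thesis using stateD(4)[OF E2(2)] unfolding eq has_edge_def by blast
  next
    case False
    then have eq: "{p\<in>P. x p < \<alpha> \<and> y p < \<beta> \<and> z p < \<gamma>} = {p\<in>R. x p < \<alpha> \<and> y p < \<beta> \<and> z p < \<gamma>}"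
      using P by auto
    have "has_edge E {p\<in>R. x p < \<alpha> \<and> y p < \<beta> \<and> z p < \<gamma>}"
      using E[rule_format, OF *[unfolded eq]] .
    then show ?thesis unfolding eq by (rule has_edge_mono) (use E1(1) E2(1) in auto)
  qed
  then show ?case using E2(2) by blast
qed

end

text \<open>After passing to ranks, intersections of initial segments are given by three strict
  bounds, and a proper 2-colouring of \<open>E\<close> separates the ends of the edge in each large
  one.\<close>

theorem octant_coloring:
  fixes f g h :: "'a \<Rightarrow> 'b::linorder"
  assumes fin: "finite P"
  shows "\<exists>color :: 'a \<Rightarrow> bool. \<forall>A B C.
    initial_segment P f A \<and> initial_segment P g B \<and> initial_segment P h C \<and> card (A \<inter> B \<inter> C) \<ge> 12 \<longrightarrow>
    (\<exists>p\<in>A \<inter> B \<inter> C. \<exists>q\<in>A \<inter> B \<inter> C. color p \<noteq> color q)"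
proof -
  obtain x :: "'a \<Rightarrow> nat" where x: "inj_on x P" "\<forall>p\<in>P. \<forall>q\<in>P. f p < f q \<longrightarrow> x p < x q"
    using ex_injective_rank[OF fin, of f] by (elim exE conjE)
  obtain y :: "'a \<Rightarrow> nat" where y: "inj_on y P" "\<forall>p\<in>P. \<forall>q\<in>P. g p < g q \<longrightarrow> y p < y q"
    using ex_injective_rank[OF fin, of g] by (elim exE conjE)
  obtain z :: "'a \<Rightarrow> nat" where z: "inj_on z P" "\<forall>p\<in>P. \<forall>q\<in>P. h p < h q \<longrightarrow> z p < z q"
    using ex_injective_rank[OF fin, of h] by (elim exE conjE)
  interpret two_orders x y .
  obtain E S Q where ESQ: "state P E S Q \<and>
      (\<forall>\<alpha> \<beta> \<gamma>. card {p\<in>P. x p < \<alpha> \<and> y p < \<beta> \<and> z p < \<gamma>} \<ge> 12 \<longrightarrow>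
         has_edge E {p\<in>P. x p < \<alpha> \<and> y p < \<beta> \<and> z p < \<gamma>})"
    using ex_edges[OF fin x(1) y(1) z(1)] by (elim exE)
  note E = ESQ[THEN conjunct2, rule_format]
  obtain c :: "'a \<Rightarrow> bool" where c: "\<And>a b. (a, b) \<in> E \<Longrightarrow> c a \<noteq> c b"
  proof -
    show thesis if *: "\<And>c :: 'a \<Rightarrow> bool. (\<And>a b. (a, b) \<in> E \<Longrightarrow> c a \<noteq> c b) \<Longrightarrow> thesis"
      \<comment> \<open>Any prescription on the remaining pending points will do; a constant one is
        chosen.\<close>
      by (rule colors_freelyE[OF stateD(7)[OF ESQ[THEN conjunct1]], of "\<lambda>_. True"]) (rule *)
  qed
  show ?thesis
  proof (intro exI[of _ c] allI impI, elim conjE)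
    fix A B C
    assume seg: "initial_segment P f A" "initial_segment P g B" "initial_segment P h C"
      and card: "card (A \<inter> B \<inter> C) \<ge> 12"
    obtain \<alpha> where A: "A = {p\<in>P. x p < \<alpha>}"
      using initial_segment_rank[OF fin seg(1) x(2)] by (elim exE)
    obtain \<beta> where B: "B = {p\<in>P. y p < \<beta>}"
      using initial_segment_rank[OF fin seg(2) y(2)] by (elim exE)
    obtain \<gamma> where C: "C = {p\<in>P. z p < \<gamma>}"
      using initial_segment_rank[OF fin seg(3) z(2)] by (elim exE)
    from A B C have eq: "A \<inter> B \<inter> C = {p\<in>P. x p < \<alpha> \<and> y p < \<beta> \<and> z p < \<gamma>}" by auto
    show "\<exists>p\<in>A \<inter> B \<inter> C. \<exists>q\<in>A \<inter> B \<inter> C. c p \<noteq> c q"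
    proof -
      have "has_edge E (A \<inter> B \<inter> C)" using E[OF card[unfolded eq]] unfolding eq .
      then obtain p q where "p \<in> A \<inter> B \<inter> C" "q \<in> A \<inter> B \<inter> C" "(p, q) \<in> E"
        unfolding has_edge_def by (elim bexE)
      then show ?thesis using c[of p q] by (intro bexI[of _ p] bexI[of _ q])
    qed
  qed
qed

section \<open>Triangles as intersections of half-planes\<close>

text \<open>A vanishing determinant makes \<open>c - a\<close> parallel to \<open>b - a\<close>; the
  factor is read off from a nonzero coordinate of \<open>b - a\<close>.\<close>

lemma not_collinear_det:
  fixes a b c :: "real^2"
  assumes "\<not> collinear {a, b, c}"
  shows "(b$1 - a$1) * (c$2 - a$2) - (b$2 - a$2) * (c$1 - a$1) \<noteq> 0"
proof
  assume det: "(b$1 - a$1) * (c$2 - a$2) - (b$2 - a$2) * (c$1 - a$1) = 0"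
  have "b - a = 0 \<or> (\<exists>t. c - a = t *\<^sub>R (b - a))"
  proof (cases "b$1 = a$1")
    case True
    show ?thesis
    proof (cases "b$2 = a$2")
      case True
      then show ?thesis using \<open>b$1 = a$1\<close> by (simp add: vec_eq_iff forall_2)
    next
      case False
      then have "c - a = ((c$2 - a$2) / (b$2 - a$2)) *\<^sub>R (b - a)"
        using True det by (simp add: vec_eq_iff forall_2)
      then show ?thesis by blast
    qed
  next
    case False
    then have nz: "b$1 - a$1 \<noteq> 0" by simp
    then have "c$2 - a$2 = (c$1 - a$1) / (b$1 - a$1) * (b$2 - a$2)"
      using det by (simp add: nonzero_eq_divide_eq mult.commute)
    with nz have "c - a = ((c$1 - a$1) / (b$1 - a$1)) *\<^sub>R (b - a)"
      by (simp add: vec_eq_iff forall_2)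
    then show ?thesis by blast
  qed
  then have "collinear {0, b - a, c - a}" by (auto simp: collinear_lemma)
  then have "collinear {b, a, c}" by (subst collinear_3) auto
  then show False using assms by (simp add: insert_commute)
qed

text \<open>The half-planes state that the barycentric coordinates are nonnegative, or positive for
  the open triangle.\<close>

lemma triangle_half_planes:
  assumes "is_triangle T"
  obtains f g h :: "real^2 \<Rightarrow> real" and k l m where "linear f" "linear g" "linear h"
    "T = {x. f x \<le> k \<and> g x \<le> l \<and> h x \<le> m} \<or> T = {x. f x < k \<and> g x < l \<and> h x < m}"
proof -
  obtain a b c where abc: "\<not> collinear {a, b, c}"
    and T: "T = convex hull {a, b, c} \<or> T = interior (convex hull {a, b, c})"
    using assms unfolding is_triangle_def by blast
  define D where "D = (b$1 - a$1) * (c$2 - a$2) - (b$2 - a$2) * (c$1 - a$1)"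
  have D: "D \<noteq> 0" using not_collinear_det[OF abc] by (simp add: D_def)
  \<comment> \<open>\<open>N p q x\<close> is twice the signed area of the triangle
    \<open>x\<close>, \<open>p\<close>, \<open>q\<close>. Division by \<open>D\<close> makes
    \<open>G b c\<close>, \<open>G c a\<close>, \<open>G a b\<close> the barycentric coordinates for
    \<open>a\<close>, \<open>b\<close>, \<open>c\<close>, whatever the orientation.\<close>
  define N where "N p q x = (p$1 - x$1) * (q$2 - p$2) - (p$2 - x$2) * (q$1 - p$1)"
    for p q x :: "real^2"
  define F where "F p q x = (x$1 * (q$2 - p$2) - x$2 * (q$1 - p$1)) / D" for p q x :: "real^2"
  define G where "G p q x = N p q x / D" for p q x
  have lin: "linear (F p q)" for p q
    by (rule linearI) (simp_all add: F_def algebra_simps add_divide_distrib diff_divide_distrib)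
  \<comment> \<open>Each coordinate is a constant minus a linear form, so a lower bound 0 on it is
    an upper bound on \<open>F\<close>.\<close>
  have GF: "G p q x = F p q p - F p q x" for p q x
    by (simp add: G_def N_def F_def diff_divide_distrib[symmetric] algebra_simps)
  have G: "G b c (u *\<^sub>R a + v *\<^sub>R b + w *\<^sub>R c) = u" "G c a (u *\<^sub>R a + v *\<^sub>R b + w *\<^sub>R c) = v"
    "G a b (u *\<^sub>R a + v *\<^sub>R b + w *\<^sub>R c) = w" if "u + v + w = 1" for u v w
  proof -
    have u: "u = 1 - v - w" using that by simp
    have "N b c (u *\<^sub>R a + v *\<^sub>R b + w *\<^sub>R c) = u * D" "N c a (u *\<^sub>R a + v *\<^sub>R b + w *\<^sub>R c) = v * D"
      "N a b (u *\<^sub>R a + v *\<^sub>R b + w *\<^sub>R c) = w * D"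
      unfolding u N_def D_def by (simp_all add: algebra_simps)
    then show "G b c (u *\<^sub>R a + v *\<^sub>R b + w *\<^sub>R c) = u" "G c a (u *\<^sub>R a + v *\<^sub>R b + w *\<^sub>R c) = v"
      "G a b (u *\<^sub>R a + v *\<^sub>R b + w *\<^sub>R c) = w"
      using D by (simp_all add: G_def)
  qed
  have one: "G b c x + G c a x + G a b x = 1" for x
  proof -
    have "N b c x + N c a x + N a b x = D" by (simp add: N_def D_def algebra_simps)
    then show ?thesis using D by (simp add: G_def add_divide_distrib[symmetric])
  qed
  have bary: "G b c x *\<^sub>R a + G c a x *\<^sub>R b + G a b x *\<^sub>R c = x" for x
  proof -
    have "N b c x * a$i + N c a x * b$i + N a b x * c$i = x$i * D" if "i = 1 \<or> i = 2" for i
      using that by (auto simp: N_def D_def algebra_simps)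
    then have "(N b c x * a$i + N c a x * b$i + N a b x * c$i) / D = x$i" if "i = 1 \<or> i = 2" for i
      using D that by simp
    then show ?thesis by (simp add: G_def vec_eq_iff forall_2 add_divide_distrib)
  qed
  have "convex hull {a, b, c} = {x. G b c x \<ge> 0 \<and> G c a x \<ge> 0 \<and> G a b x \<ge> 0}"
  proof (intro equalityI subsetI)
    fix x assume "x \<in> convex hull {a, b, c}"
    then show "x \<in> {x. G b c x \<ge> 0 \<and> G c a x \<ge> 0 \<and> G a b x \<ge> 0}"
      unfolding convex_hull_3 by (auto simp: G)
  next
    fix x assume "x \<in> {x. G b c x \<ge> 0 \<and> G c a x \<ge> 0 \<and> G a b x \<ge> 0}"
    then show "x \<in> convex hull {a, b, c}"
      unfolding convex_hull_3 mem_Collect_eq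
      by (intro exI[of _ "G b c x"] exI[of _ "G c a x"] exI[of _ "G a b x"]) (simp add: bary one)
  qed
  moreover have "interior (convex hull {a, b, c}) = {x. G b c x > 0 \<and> G c a x > 0 \<and> G a b x > 0}"
  proof -
    have "interior (convex hull {a, b, c}) =
        {x. \<exists>u v w. 0 < u \<and> 0 < v \<and> 0 < w \<and> u + v + w = 1 \<and> u *\<^sub>R a + v *\<^sub>R b + w *\<^sub>R c = x}"
      by (rule interior_convex_hull_3_minimal[OF abc]) simp
    also have "\<dots> = {x. G b c x > 0 \<and> G c a x > 0 \<and> G a b x > 0}" (is "?A = ?B")
    proof (intro equalityI subsetI)
      fix x assume "x \<in> ?A"
      then show "x \<in> ?B" by (auto simp: G)
    next
      fix x assume "x \<in> ?B"
      then show "x \<in> ?A" unfolding mem_Collect_eq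
        by (intro exI[of _ "G b c x"] exI[of _ "G c a x"] exI[of _ "G a b x"]) (simp add: bary one)
    qed
    finally show ?thesis .
  qed
  ultimately have "T = {x. F b c x \<le> F b c b \<and> F c a x \<le> F c a c \<and> F a b x \<le> F a b a} \<or>
      T = {x. F b c x < F b c b \<and> F c a x < F c a c \<and> F a b x < F a b a}"
    using T by (simp add: GF)
  then show thesis by (rule that[OF lin lin lin])
qed

text \<open>A homothety with positive ratio only shifts the three thresholds, so all copies cut
  initial segments of the same three linear forms, and one octant colouring serves them all.\<close>

theorem corollary6:
  fixes T P :: "(real^2) set"
  assumes "is_triangle T" and "finite P"
  shows "\<exists>color :: real^2 \<Rightarrow> bool. \<forall>S. homothetic_copy T S \<and> card (P \<inter> S) \<ge> 12 \<longrightarrow>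
           (\<exists>p \<in> P \<inter> S. \<exists>q \<in> P \<inter> S. color p \<noteq> color q)"
proof -
  obtain f g h :: "real^2 \<Rightarrow> real" and k l m where lin: "linear f" "linear g" "linear h"
    and T: "T = {x. f x \<le> k \<and> g x \<le> l \<and> h x \<le> m} \<or> T = {x. f x < k \<and> g x < l \<and> h x < m}"
    by (rule triangle_half_planes[OF assms(1)])
  obtain color :: "real^2 \<Rightarrow> bool" where color: "\<forall>A B C.
      initial_segment P f A \<and> initial_segment P g B \<and> initial_segment P h C \<and> card (A \<inter> B \<inter> C) \<ge> 12 \<longrightarrow>
      (\<exists>p\<in>A \<inter> B \<inter> C. \<exists>q\<in>A \<inter> B \<inter> C. color p \<noteq> color q)"
    using octant_coloring[OF assms(2), of f g h] by (elim exE)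
  have segs: "\<exists>A B C. initial_segment P f A \<and> initial_segment P g B \<and> initial_segment P h C \<and>
      P \<inter> S = A \<inter> B \<inter> C" if hc: "homothetic_copy T S" for S
  proof -
    obtain r v where r: "r > 0" and S: "S = (\<lambda>x. r *\<^sub>R x + v) ` T"
      using hc unfolding homothetic_copy_def by blast
    have mem: "p \<in> S \<longleftrightarrow> (p - v) /\<^sub>R r \<in> T" for p
    proof
      assume "p \<in> S"
      then show "(p - v) /\<^sub>R r \<in> T" using r by (auto simp: S)
    next
      assume "(p - v) /\<^sub>R r \<in> T"
      moreover have "p = r *\<^sub>R ((p - v) /\<^sub>R r) + v" using r by simp
      ultimately show "p \<in> S" unfolding S by blast
    qed
    have le: "F ((p - v) /\<^sub>R r) \<le> d \<longleftrightarrow> F p \<le> r * d + F v"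
      and less: "F ((p - v) /\<^sub>R r) < d \<longleftrightarrow> F p < r * d + F v" if "linear F" for F p d
      using r by (simp_all add: linear_cmul[OF that] linear_diff[OF that] field_simps)
    have seg_le: "initial_segment P F {p\<in>P. F p \<le> d}"
      and seg_less: "initial_segment P F {p\<in>P. F p < d}" for F and d :: real
      by (auto simp: initial_segment_def)
    from T show ?thesis
    proof
      assume "T = {x. f x \<le> k \<and> g x \<le> l \<and> h x \<le> m}"
      then show ?thesis
        by (intro exI[of _ "{p\<in>P. f p \<le> r * k + f v}"] exI[of _ "{p\<in>P. g p \<le> r * l + g v}"]
            exI[of _ "{p\<in>P. h p \<le> r * m + h v}"] conjI seg_le) (auto simp: mem le[OF lin(1)] le[OF lin(2)] le[OF lin(3)])
    next
      assume "T = {x. f x < k \<and> g x < l \<and> h x < m}"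
      then show ?thesis
        by (intro exI[of _ "{p\<in>P. f p < r * k + f v}"] exI[of _ "{p\<in>P. g p < r * l + g v}"]
            exI[of _ "{p\<in>P. h p < r * m + h v}"] conjI seg_less) (auto simp: mem less[OF lin(1)] less[OF lin(2)] less[OF lin(3)])
    qed
  qed
  show ?thesis
  proof (intro exI[of _ color] allI impI, elim conjE)
    fix S
    assume "homothetic_copy T S" and card: "card (P \<inter> S) \<ge> 12"
    then obtain A B C where "initial_segment P f A" "initial_segment P g B" "initial_segment P h C"
      and "P \<inter> S = A \<inter> B \<inter> C" using segs by blast
    then show "\<exists>p \<in> P \<inter> S. \<exists>q \<in> P \<inter> S. color p \<noteq> color q" using color[rule_format, of A B C] card by simp
  qed
qed

end
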